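(* Let $Z_1,Z_2,Z_3\in\mathbb R^2$ be the vertices of a (nondegenerate) triangle and let $d_1,d_2,d_3>0$. Let $X$ be the set of global minimizers over $W\in\mathbb R^2$ of $O(W)=\sum_{j=1}^3\left|\,\|W-Z_j\|^2-d_j^2\right|$. Suppose that $$\|Z_1Z_3\|=\|Z_2Z_3\|,\qquad d_1=d_2>\|Z_1Z_3\|,\qquad d_3^2=d_1^2-\|Z_1Z_3\|^2 .$$ When $\|Z_1Z_3\|>\|Z_1Z_2\|$, set $$P=\sqrt{\frac{\|Z_1Z_2\|^2}{4}+\left(\|Z_1Z_3\|^2-\frac{\|Z_1Z_2\|^2}{4}\right)\left(\frac{\|Z_1Z_3\|^2+\|Z_1Z_2\|^2}{\|Z_1Z_3\|^2-\|Z_1Z_2\|^2}\right)^2}.$$ Then: (i) if $\|Z_1Z_3\|\le\|Z_1Z_2\|$, or if $\|Z_1Z_3\|>\|Z_1Z_2\|$ and $d_1<P$, then $X=\{S_{12+}\}$; (ii) if $\|Z_1Z_3\|>\|Z_1Z_2\|$ and $d_1=P$, then $X=\{S_{12+},S_{23+},S_{23-},S_{31+},S_{31-}\}$; (iii) if $\|Z_1Z_3\|>\|Z_1Z_2\|$ and $d_1>P$, then $X=\{S_{23+},S_{23-},S_{31+},S_{31-}\}$.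
   Context: $\|Z_iZ_j\|$ denotes the Euclidean distance $\|Z_i-Z_j\|$. $S_j=\{W\in\mathbb R^2:\|W-Z_j\|=d_j\}$ and $S_{ij}=S_i\cap S_j$. If $\{i,j,k\}=\{1,2,3\}$ and $|S_{ij}|=2$, then $S_{ij+}$ and $S_{ij-}$ are the points of $S_{ij}$ at the shortest and the longest distance from $Z_k$, respectively; if $|S_{ij}|=1$, both denote the single point of $S_{ij}$. *)

theory Defs
  imports "HOL-Analysis.Analysis"
begin

text \<open>
  The points \<open>Z\<^sub>1, Z\<^sub>2, Z\<^sub>3\<close> and the radii \<open>d\<^sub>1, d\<^sub>2, d\<^sub>3\<close> are given by functions on \<open>nat\<close>, of which
  only the values at \<open>1, 2, 3\<close> are used.
\<close>

definition objective :: "(nat \<Rightarrow> real^2) \<Rightarrow> (nat \<Rightarrow> real) \<Rightarrow> real^2 \<Rightarrow> real" where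
  "objective Z d W = (\<Sum>j=1..3. \<bar>(norm (W - Z j))\<^sup>2 - (d j)\<^sup>2\<bar>)"

definition minimizers :: "(nat \<Rightarrow> real^2) \<Rightarrow> (nat \<Rightarrow> real) \<Rightarrow> (real^2) set" where
  "minimizers Z d = {W. \<forall>V. objective Z d W \<le> objective Z d V}"

definition circles_inter :: "(nat \<Rightarrow> real^2) \<Rightarrow> (nat \<Rightarrow> real) \<Rightarrow> nat \<Rightarrow> nat \<Rightarrow> (real^2) set" where
  "circles_inter Z d i j = sphere (Z i) (d i) \<inter> sphere (Z j) (d j)"

text \<open>
  The points \<open>S\<^sub>i\<^sub>j\<^sub>+\<close> and \<open>S\<^sub>i\<^sub>j\<^sub>-\<close>, with the third index \<open>k\<close>, where \<open>{i, j, k} = {1, 2, 3}\<close>, passed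
  explicitly.  They are meaningful only if the two circles meet in one or two points.  If the three
  centres are not collinear, there are no ties: two common points of the circles are mirror images
  in the line through \<open>Z\<^sub>i\<close> and \<open>Z\<^sub>j\<close>, so they have different distances from \<open>Z\<^sub>k\<close>.
\<close>

definition S_plus :: "(nat \<Rightarrow> real^2) \<Rightarrow> (nat \<Rightarrow> real) \<Rightarrow> nat \<Rightarrow> nat \<Rightarrow> nat \<Rightarrow> real^2" where
  "S_plus Z d i j k = arg_min (\<lambda>W. dist W (Z k)) (\<lambda>W. W \<in> circles_inter Z d i j)"

definition S_minus :: "(nat \<Rightarrow> real^2) \<Rightarrow> (nat \<Rightarrow> real) \<Rightarrow> nat \<Rightarrow> nat \<Rightarrow> nat \<Rightarrow> real^2" where
  "S_minus Z d i j k = arg_max (\<lambda>W. dist W (Z k)) (\<lambda>W. W \<in> circles_inter Z d i j)"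

text \<open>Meaningful only if \<open>dist (Z 1) (Z 3) > dist (Z 1) (Z 2)\<close>.\<close>

definition threshold :: "(nat \<Rightarrow> real^2) \<Rightarrow> real" where
  "threshold Z =
    sqrt ((dist (Z 1) (Z 2))\<^sup>2 / 4 +
      ((dist (Z 1) (Z 3))\<^sup>2 - (dist (Z 1) (Z 2))\<^sup>2 / 4) *
      (((dist (Z 1) (Z 3))\<^sup>2 + (dist (Z 1) (Z 2))\<^sup>2) /
       ((dist (Z 1) (Z 3))\<^sup>2 - (dist (Z 1) (Z 2))\<^sup>2))\<^sup>2)"

end

theory Submission
  imports Defs
begin

(* Put Z 3 at the origin, Z 1 = (m, h) and Z 2 = (-m, h), and write r = d 3, so that the hypotheses turn
   the three terms of the objective into |N - r^2|, |N - 2 u - r^2| and |N - 2 v - r^2|, where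
   N = norm W ^ 2 and u, v are the inner products of W with Z 1, Z 2.  The signs of u, v and u - v cut
   the plane into six cones.  Each cone is spanned by two points A, B in which two of the circles meet,
   and on it the objective is bounded below by a linear function l and by a strictly concave
   function k, both of which agree with the objective at A and B; moreover k(0) = r^2 exceeds the
   value at S_12+.  Beyond the line AB the bound l suffices, and in the triangle 0AB the bound k does. *)

section \<open>Minimizing over a cone\<close>

text \<open>The second lower bound on \<open>v\<close> is a concave quadratic function with leading part minus the
  squared norm, evaluated at \<open>s *\<^sub>R A + t *\<^sub>R B\<close>: there \<open>a\<close>, \<open>b\<close>, \<open>\<delta>\<close> are the squared norms of
  \<open>A\<close>, \<open>B\<close>, \<open>A - B\<close>, and its values at \<open>0\<close>, \<open>A\<close>, \<open>B\<close> are \<open>D\<close>, \<open>\<alpha>\<close>, \<open>\<beta>\<close>.\<close>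

lemma cone_bound:
  fixes v s t D a b \<alpha> \<beta> \<delta> T :: real
  assumes "0 \<le> s" "0 \<le> t" "0 \<le> a" "0 \<le> b" "0 < \<delta>"
    and T: "0 < T" "T < D" "T \<le> \<alpha>" "T \<le> \<beta>"
    and lin: "s * \<alpha> + t * \<beta> \<le> v"
    and conc: "(1 - s - t) * (D + s * a + t * b) + s * \<alpha> + t * \<beta> + s * t * \<delta> \<le> v"
  shows "T \<le> v" and "v = T \<Longrightarrow> s = 1 \<and> t = 0 \<and> \<alpha> = T \<or> s = 0 \<and> t = 1 \<and> \<beta> = T"
proof -
  have st: "(s + t) * T \<le> s * \<alpha> + t * \<beta>"
    using mult_left_mono[OF T(3) assms(1)] mult_left_mono[OF T(4) assms(2)]
    by (simp add: algebra_simps)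
  have pos: "0 \<le> s * t * \<delta>" "0 \<le> s * a + t * b"
    using assms by simp_all
  consider "s + t < 1" | "s + t = 1" | "s + t > 1" by linarith
  then have "T \<le> v \<and> (v = T \<longrightarrow> s = 1 \<and> t = 0 \<and> \<alpha> = T \<or> s = 0 \<and> t = 1 \<and> \<beta> = T)"
  proof cases
    case 1
    \<comment> \<open>On the origin's side of the line AB the positive weight 1 - s - t falls on a
      quantity of at least \<open>D\<close> > \<open>T\<close>, so the bound is strict.\<close>
    have "(1 - s - t) * T < (1 - s - t) * (D + s * a + t * b)"
      using 1 T pos by (intro mult_strict_left_mono) auto
    then have "T < v"
      using st conc pos by (simp add: algebra_simps)
    then show ?thesis by simp
  next
    case 2
    then have z: "1 - s - t = 0" by simp
    \<comment> \<open>On the segment AB the weight of \<open>D\<close> vanishes; the term left over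
      by strict concavity forces equality to occur only at an endpoint.\<close>
    have "T + s * t * \<delta> \<le> v"
      using 2 st conc unfolding z by simp
    moreover have "s = 0 \<or> t = 0" if "v = T"
    proof -
      have "s * t * \<delta> = 0" using calculation that pos(1) by simp
      then show ?thesis using \<open>0 < \<delta>\<close> by simp
    qed
    moreover have "\<alpha> = T" if "v = T" "s = 1" "t = 0"
      using lin T(3) that by simp
    moreover have "\<beta> = T" if "v = T" "s = 0" "t = 1"
      using lin T(4) that by simp
    moreover have "s = 0 \<longrightarrow> t = 1" "t = 0 \<longrightarrow> s = 1" using 2 by simp_all
    moreover have "T \<le> v" using calculation(1) pos(1) by linarith
    ultimately show ?thesis by blast
  next
    case 3
    \<comment> \<open>Beyond AB the concave bound may drop, but the linear one grows past
      \<open>T\<close> because \<open>T\<close> is positive.\<close>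
    then have "T < (s + t) * T" using T by simp
    then show ?thesis using st lin by simp
  qed
  then show "T \<le> v" and "v = T \<Longrightarrow> s = 1 \<and> t = 0 \<and> \<alpha> = T \<or> s = 0 \<and> t = 1 \<and> \<beta> = T"
    by auto
qed

section \<open>The minimum in coordinates\<close>

text \<open>With \<open>Z\<^sub>3\<close> at the origin and \<open>Z\<^sub>1 = (m, h)\<close>, \<open>Z\<^sub>2 = (-m, h)\<close>, the circles meet in
  \<open>S\<^sub>1\<^sub>2 = {(0, -y\<^sub>0), (0, y\<^sub>0 + 2 h)}\<close>, \<open>S\<^sub>2\<^sub>3 = {(p, q), (-p, -q)}\<close> and
  \<open>S\<^sub>3\<^sub>1 = {(p, -q), (-p, q)}\<close>.\<close>

locale isosceles =
  fixes m h r y0 p q :: real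
  assumes pos: "0 < m" "0 < h" "0 < r" "0 < y0" "0 < p" "0 < q"
    and y0: "y0\<^sup>2 + 2 * h * y0 = r\<^sup>2"
    and pq: "p\<^sup>2 + q\<^sup>2 = r\<^sup>2" and mp: "m * p = h * q"
begin

text \<open>The squared radius of circles 1 and 2 is r^2 + m^2 + h^2, which leaves the constant -
  r^2. Thus \<open>f1\<close>, \<open>f2\<close>, \<open>f3\<close> are the powers of (x, y) with
  respect to the three circles, and the origin is their radical centre.\<close>

definition f1 :: "real \<Rightarrow> real \<Rightarrow> real" where
  "f1 x y = x\<^sup>2 + y\<^sup>2 - 2 * (m * x + h * y) - r\<^sup>2"

definition f2 :: "real \<Rightarrow> real \<Rightarrow> real" where
  "f2 x y = x\<^sup>2 + y\<^sup>2 - 2 * (h * y - m * x) - r\<^sup>2"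

definition f3 :: "real \<Rightarrow> real \<Rightarrow> real" where
  "f3 x y = x\<^sup>2 + y\<^sup>2 - r\<^sup>2"

definition F :: "real \<Rightarrow> real \<Rightarrow> real" where
  "F x y = \<bar>f1 x y\<bar> + \<bar>f2 x y\<bar> + \<bar>f3 x y\<bar>"

text \<open>The smaller of the values at the candidates, S_12+ and the four points (+-p, +-q); by
  \<open>F_lower\<close> no smaller value occurs.\<close>

definition F_min :: real where
  "F_min = min (2 * h * y0) (4 * m * p)"

text \<open>Reflection in the line x = 0 swaps circles 1 and 2, so only three of the six cones need
  treatment.\<close>

lemma F_uminus: "F (- x) y = F x y"
proof -
  have "f1 (- x) y = f2 x y" "f2 (- x) y = f1 x y" "f3 (- x) y = f3 x y"
    by (simp_all add: f1_def f2_def f3_def)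
  then show ?thesis by (simp add: F_def)
qed

lemma F_A: "F 0 (- y0) = 2 * h * y0"
proof -
  have "0 < h * y0" using pos by simp
  then show ?thesis using y0 by (simp add: F_def f1_def f2_def f3_def)
qed

lemma F_B:
  assumes "x = p \<or> x = - p" "y = q \<or> y = - q"
  shows "F x y = 4 * m * p"
proof -
  have "0 < m * p" using pos by simp
  then show ?thesis
    using assms pq mp by (auto simp: F_def f1_def f2_def f3_def)
qed

text \<open>Each absolute value is bounded below by the term, its negative or 0. In the first three
  bounds the squared norm cancels, so they are linear; the last two keep minus the squared norm, so
  they are strictly concave, with value r^2 at the origin.\<close>

lemma F_ge:
  "f3 x y - f1 x y \<le> F x y" "f2 x y - f1 x y \<le> F x y" "f2 x y - f3 x y \<le> F x y"
  "f3 x y - f1 x y - f2 x y \<le> F x y" "f2 x y - f1 x y - f3 x y \<le> F x y"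
proof -
  note mono = order_trans[OF _ add_mono[OF add_mono]]
  show "f3 x y - f1 x y \<le> F x y" unfolding F_def
    by (rule mono[OF _ abs_ge_minus_self abs_ge_zero abs_ge_self]) simp
  show "f2 x y - f1 x y \<le> F x y" unfolding F_def
    by (rule mono[OF _ abs_ge_minus_self abs_ge_self abs_ge_zero]) simp
  show "f2 x y - f3 x y \<le> F x y" unfolding F_def
    by (rule mono[OF _ abs_ge_zero abs_ge_self abs_ge_minus_self]) simp
  show "f3 x y - f1 x y - f2 x y \<le> F x y" unfolding F_def
    by (rule mono[OF _ abs_ge_minus_self abs_ge_minus_self abs_ge_self]) simp
  show "f2 x y - f1 x y - f3 x y \<le> F x y" unfolding F_def
    by (rule mono[OF _ abs_ge_minus_self abs_ge_self abs_ge_minus_self]) simp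
qed

text \<open>The equation for \<open>y0\<close> gives 2 h y0 = r^2 - y0^2, hence the strict bound
  that \<open>cone_bound\<close> needs at the origin.\<close>

lemma F_min: "0 < F_min" "F_min < r\<^sup>2" "F_min \<le> 2 * h * y0" "F_min \<le> 4 * m * p"
proof -
  have "2 * h * y0 < r\<^sup>2" using pos(4) unfolding y0[symmetric] by simp
  then show "F_min < r\<^sup>2" unfolding F_min_def by (rule min.strict_coboundedI1)
qed (use pos in \<open>simp_all add: F_min_def\<close>)

lemma F_lower_nonneg:
  assumes "0 \<le> x"
  shows "F_min \<le> F x y"
    and "F x y = F_min \<Longrightarrow> x = 0 \<and> y = - y0 \<and> 2 * h * y0 = F_min \<or>
           x = p \<and> (y = q \<or> y = - q) \<and> 4 * m * p = F_min"
proof -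
  \<comment> \<open>The rays through (p, q) and (p, -q), on which \<open>|h y| = m x\<close> by
    \<open>mp\<close>, cut the half-plane into three cones.\<close>
  consider (I) "m * x \<le> h * y" | (II) "\<bar>h * y\<bar> \<le> m * x" | (III) "m * x \<le> - (h * y)"
    by linarith
  then have "F_min \<le> F x y \<and> (F x y = F_min \<longrightarrow> x = 0 \<and> y = - y0 \<and> 2 * h * y0 = F_min \<or>
           x = p \<and> (y = q \<or> y = - q) \<and> 4 * m * p = F_min)"
  proof cases
    case I
    \<comment> \<open>The point (0, y1) is S_12-; cone I is spanned by it and (p, q).\<close>
    define y1 where "y1 = y0 + 2 * h"
    have y1: "0 < y1" "y1\<^sup>2 = r\<^sup>2 + 2 * h * y1"
      using pos y0 by (auto simp: y1_def power2_eq_square algebra_simps)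
    define t where "t = x / p"
    define s where "s = (y - t * q) / y1"
    have W: "x = t * p" "y = s * y1 + t * q"
      using pos y1 by (auto simp: s_def t_def)
    have "m * x = h * (t * q)" unfolding W(1) using mp by algebra
    then have "0 \<le> h * (y - t * q)" using I by (simp add: right_diff_distrib)
    then have s: "0 \<le> s" using pos y1 by (simp add: s_def zero_le_mult_iff)
    have t: "0 \<le> t" using assms pos by (simp add: t_def)
    have \<delta>: "0 < p\<^sup>2 + (y1 - q)\<^sup>2" using pos by (simp add: add_pos_nonneg)
    \<comment> \<open>Strictness here excludes S_12- as a minimizer.\<close>
    have T: "F_min < 2 * h * y1"
    proof -
      have "h * y0 < h * y1" using pos by (simp add: y1_def)
      then show ?thesis using F_min(3) by linarith
    qed
    have "s * (2 * h * y1) + t * (4 * m * p) = f3 x y - f1 x y"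
      unfolding f1_def f3_def W using mp by algebra
    also have "\<dots> \<le> F x y" by (rule F_ge)
    finally have lin: "s * (2 * h * y1) + t * (4 * m * p) \<le> F x y" .
    have "(1 - s - t) * (r\<^sup>2 + s * y1\<^sup>2 + t * r\<^sup>2) + s * (2 * h * y1) + t * (4 * m * p)
        + s * t * (p\<^sup>2 + (y1 - q)\<^sup>2) = f3 x y - f1 x y - f2 x y"
      unfolding f1_def f2_def f3_def W using mp pq y1(2) by algebra
    also have "\<dots> \<le> F x y" by (rule F_ge)
    finally have conc: "(1 - s - t) * (r\<^sup>2 + s * y1\<^sup>2 + t * r\<^sup>2) + s * (2 * h * y1) + t * (4 * m * p)
        + s * t * (p\<^sup>2 + (y1 - q)\<^sup>2) \<le> F x y" .
    note * = cone_bound[OF s t zero_le_power2 zero_le_power2 \<delta> F_min(1,2) less_imp_le[OF T] F_min(4)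
      lin conc]
    show ?thesis using * T W by auto
  next
    case II
    \<comment> \<open>Cone II is spanned by (p, q) and (p, -q), at which \<open>F\<close> has the
      same value.\<close>
    define s t where "s = (x / p + y / q) / 2" and "t = (x / p - y / q) / 2"
    have W: "x = (s + t) * p" "y = (s - t) * q"
      using pos by (auto simp: s_def t_def field_simps)
    have "\<bar>s - t\<bar> * (h * q) \<le> (s + t) * (h * q)"
    proof -
      have "h * y = (s - t) * (h * q)" unfolding W by algebra
      moreover have "m * x = (s + t) * (h * q)" unfolding W using mp by algebra
      ultimately show ?thesis using II pos by (simp add: abs_mult)
    qed
    then have "\<bar>s - t\<bar> \<le> s + t" using pos by simp
    then have st: "0 \<le> s" "0 \<le> t" by linarith+
    have \<delta>: "0 < (2 * q)\<^sup>2" using pos by simp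
    have "s * (4 * m * p) + t * (4 * m * p) = f2 x y - f1 x y"
      unfolding f1_def f2_def W by algebra
    also have "\<dots> \<le> F x y" by (rule F_ge)
    finally have lin: "s * (4 * m * p) + t * (4 * m * p) \<le> F x y" .
    have "(1 - s - t) * (r\<^sup>2 + s * r\<^sup>2 + t * r\<^sup>2) + s * (4 * m * p) + t * (4 * m * p)
        + s * t * (2 * q)\<^sup>2 = f2 x y - f1 x y - f3 x y"
      unfolding f1_def f2_def f3_def W using pq by algebra
    also have "\<dots> \<le> F x y" by (rule F_ge)
    finally have conc: "(1 - s - t) * (r\<^sup>2 + s * r\<^sup>2 + t * r\<^sup>2) + s * (4 * m * p)
        + t * (4 * m * p) + s * t * (2 * q)\<^sup>2 \<le> F x y" .
    note * = cone_bound[OF st zero_le_power2 zero_le_power2 \<delta> F_min(1,2,4,4) lin conc]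
    show ?thesis using * W by auto
  next
    case III
    \<comment> \<open>Cone III is spanned by S_12+ = (0, -y0) and (p, -q).\<close>
    define t where "t = x / p"
    define s where "s = (- y - t * q) / y0"
    have W: "x = t * p" "y = - (s * y0 + t * q)"
      using pos by (auto simp: s_def t_def)
    have "m * x = h * (t * q)" unfolding W(1) using mp by algebra
    then have "0 \<le> h * (- y - t * q)" using III by (simp add: right_diff_distrib)
    then have s: "0 \<le> s" using pos by (simp add: s_def zero_le_mult_iff)
    have t: "0 \<le> t" using assms pos by (simp add: t_def)
    have \<delta>: "0 < p\<^sup>2 + (y0 - q)\<^sup>2" using pos by (simp add: add_pos_nonneg)
    have "s * (2 * h * y0) + t * (4 * m * p) = f2 x y - f3 x y"
      unfolding f2_def f3_def W using mp by algebra
    also have "\<dots> \<le> F x y" by (rule F_ge)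
    finally have lin: "s * (2 * h * y0) + t * (4 * m * p) \<le> F x y" .
    have "(1 - s - t) * (r\<^sup>2 + s * y0\<^sup>2 + t * r\<^sup>2) + s * (2 * h * y0) + t * (4 * m * p)
        + s * t * (p\<^sup>2 + (y0 - q)\<^sup>2) = f2 x y - f1 x y - f3 x y"
      unfolding f1_def f2_def f3_def W using mp pq y0 by algebra
    also have "\<dots> \<le> F x y" by (rule F_ge)
    finally have conc: "(1 - s - t) * (r\<^sup>2 + s * y0\<^sup>2 + t * r\<^sup>2) + s * (2 * h * y0) + t * (4 * m * p)
        + s * t * (p\<^sup>2 + (y0 - q)\<^sup>2) \<le> F x y" .
    note * = cone_bound[OF s t zero_le_power2 zero_le_power2 \<delta> F_min lin conc]
    show ?thesis using * W by auto
  qed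
  then show "F_min \<le> F x y"
    and "F x y = F_min \<Longrightarrow> x = 0 \<and> y = - y0 \<and> 2 * h * y0 = F_min \<or>
           x = p \<and> (y = q \<or> y = - q) \<and> 4 * m * p = F_min"
    by auto
qed

lemma F_lower: "F_min \<le> F x y"
  using F_lower_nonneg(1)[of x y] F_lower_nonneg(1)[of "- x" y]
  by (cases "0 \<le> x") (auto simp: F_uminus)

lemma F_eq_F_min_iff:
  "F x y = F_min \<longleftrightarrow> x = 0 \<and> y = - y0 \<and> 2 * h * y0 \<le> 4 * m * p \<or>
     (x = p \<or> x = - p) \<and> (y = q \<or> y = - q) \<and> 4 * m * p \<le> 2 * h * y0"
    (is "_ \<longleftrightarrow> ?R")
proof -
  have *: "2 * h * y0 = F_min \<longleftrightarrow> 2 * h * y0 \<le> 4 * m * p"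
    "4 * m * p = F_min \<longleftrightarrow> 4 * m * p \<le> 2 * h * y0"
    by (simp_all add: F_min_def min_def)
  have "?R" if eq: "F x y = F_min"
  proof (cases "0 \<le> x")
    case True
    from F_lower_nonneg(2)[OF this eq] show ?thesis unfolding * by blast
  next
    case False
    then have "0 \<le> - x" by simp
    from F_lower_nonneg(2)[OF this] eq show ?thesis
      unfolding F_uminus * equation_minus_iff[of x] minus_equation_iff[of x] by auto
  qed
  moreover have "F x y = F_min" if "?R"
  proof -
    from that consider "x = 0" "y = - y0" "2 * h * y0 = F_min"
      | "x = p \<or> x = - p" "y = q \<or> y = - q" "4 * m * p = F_min"
      unfolding * by blast
    then show ?thesis
    proof cases
      case 1
      then show ?thesis using F_A by simp
    next
      case 2
      then show ?thesis using F_B by simp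
    qed
  qed
  ultimately show ?thesis by blast
qed

lemma F_minimal_iff: "(\<forall>x' y'. F x y \<le> F x' y') \<longleftrightarrow> F x y = F_min"
proof
  assume *: "\<forall>x' y'. F x y \<le> F x' y'"
  have "F x y \<le> F_min"
    using *[rule_format, of 0 "- y0"] *[rule_format, of p q] F_B[of p q]
    by (simp add: F_A F_min_def)
  then show "F x y = F_min" using F_lower[of x y] by simp
qed (use F_lower in simp)

section \<open>Circle intersections and comparison of the candidate values\<close>

lemma circles_12:
  "(x - m)\<^sup>2 + (y - h)\<^sup>2 = r\<^sup>2 + m\<^sup>2 + h\<^sup>2 \<and> (x + m)\<^sup>2 + (y - h)\<^sup>2 = r\<^sup>2 + m\<^sup>2 + h\<^sup>2 \<longleftrightarrow>
     x = 0 \<and> (y = - y0 \<or> y = y0 + 2 * h)"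
proof
  assume *: "(x - m)\<^sup>2 + (y - h)\<^sup>2 = r\<^sup>2 + m\<^sup>2 + h\<^sup>2 \<and> (x + m)\<^sup>2 + (y - h)\<^sup>2 = r\<^sup>2 + m\<^sup>2 + h\<^sup>2"
  then have "m * x = 0" by algebra
  then have x: "x = 0" using pos by simp
  \<comment> \<open>With x = 0 both equations become y^2 - 2 h y - r^2 = 0; its roots have sum 2 h
    and product - r^2.\<close>
  with * y0 have "(y + y0) * (y - (y0 + 2 * h)) = 0" by algebra
  then show "x = 0 \<and> (y = - y0 \<or> y = y0 + 2 * h)" using x by auto
qed (use y0 in \<open>auto simp: power2_eq_square algebra_simps\<close>)

text \<open>The sign \<open>e\<close> selects circle 1 (\<open>e = 1\<close>) or circle 2
  (\<open>e = - 1\<close>). Its radical axis with circle 3 passes through the origin, the centre of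
  circle 3, so the common points are antipodal.\<close>

lemma circles_3:
  assumes "e = 1 \<or> e = - 1"
  shows "(x - e * m)\<^sup>2 + (y - h)\<^sup>2 = r\<^sup>2 + m\<^sup>2 + h\<^sup>2 \<and> x\<^sup>2 + y\<^sup>2 = r\<^sup>2 \<longleftrightarrow>
     x = p \<and> y = - e * q \<or> x = - p \<and> y = e * q"
proof
  have e: "e * e = 1" using assms by auto
  assume *: "(x - e * m)\<^sup>2 + (y - h)\<^sup>2 = r\<^sup>2 + m\<^sup>2 + h\<^sup>2 \<and> x\<^sup>2 + y\<^sup>2 = r\<^sup>2"
  then have "e * m * x + h * y = 0" using e by algebra
  then have "h * (p * y + e * q * x) = 0" using mp by algebra
  then have y: "p * y = - e * q * x" using pos by simp
  with * pq e have "r\<^sup>2 * ((x - p) * (x + p)) = 0" by algebra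
  then have "x = p \<or> x = - p" using pos by auto
  moreover have "p * (y + e * q) = 0" if "x = p" using y that by algebra
  moreover have "p * (y - e * q) = 0" if "x = - p" using y that by algebra
  ultimately show "x = p \<and> y = - e * q \<or> x = - p \<and> y = e * q"
    using pos by auto
next
  assume *: "x = p \<and> y = - e * q \<or> x = - p \<and> y = e * q"
  have e: "e * e = 1" using assms by auto
  show "(x - e * m)\<^sup>2 + (y - h)\<^sup>2 = r\<^sup>2 + m\<^sup>2 + h\<^sup>2 \<and> x\<^sup>2 + y\<^sup>2 = r\<^sup>2"
    using * pq mp e by (elim disjE conjE; intro conjI; hypsubst; algebra)
qed

text \<open>By \<open>mp\<close> the values are 2 h y0 and 2 h t with t = 2 q. As \<open>y0\<close>
  is the positive root of y^2 + 2 h y - r^2, the sign of t - y0 is that of this quadratic at t, and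
  multiplying by L^2 turns the latter into r \<Delta>.\<close>

lemma value_compare:
  assumes "0 < L" "q * L = m * r"
  defines "\<Delta> \<equiv> 2 * h * (2 * m) * L - r * (L\<^sup>2 - (2 * m)\<^sup>2)"
  shows "2 * h * y0 < 4 * m * p \<longleftrightarrow> 0 < \<Delta>" and "2 * h * y0 = 4 * m * p \<longleftrightarrow> \<Delta> = 0"
    and "4 * m * p < 2 * h * y0 \<longleftrightarrow> \<Delta> < 0"
proof -
  define t where "t = 2 * q"
  define k where "k = r / L\<^sup>2 / (t + y0 + 2 * h)"
  have mt: "4 * m * p = 2 * h * t" using mp by (simp add: t_def)
  have "0 < t" using pos(6) by (simp add: t_def)
  then have fac: "0 < t + y0 + 2 * h" using pos(2,4) by simp
  then have k: "0 < k" using pos(3) assms(1) by (simp add: k_def)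
  have "(t - y0) * (t + y0 + 2 * h) * L\<^sup>2 = r * \<Delta>"
    unfolding t_def \<Delta>_def using assms(2) y0 by algebra
  then have "(t - y0) * (t + y0 + 2 * h) = r * \<Delta> / L\<^sup>2"
    using assms(1) by (simp add: eq_divide_eq)
  then have "t - y0 = r * \<Delta> / L\<^sup>2 / (t + y0 + 2 * h)"
    using fac by (metis less_irrefl nonzero_mult_div_cancel_right)
  then have t_eq: "t = y0 + k * \<Delta>" by (simp add: k_def)
  show "2 * h * y0 < 4 * m * p \<longleftrightarrow> 0 < \<Delta>" "2 * h * y0 = 4 * m * p \<longleftrightarrow> \<Delta> = 0"
    "4 * m * p < 2 * h * y0 \<longleftrightarrow> \<Delta> < 0"
    unfolding mt t_eq using pos(2) k by (simp_all add: zero_less_mult_iff mult_less_0_iff)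
qed

end

section \<open>The nearest and farthest intersection points\<close>

lemma S_plus_eq:
  assumes "circles_inter Z d i j = {A, B}" "dist A (Z k) < dist B (Z k)"
  shows "S_plus Z d i j k = A"
proof -
  have "S_plus Z d i j k \<in> {A, B} \<and> \<not> dist A (Z k) < dist (S_plus Z d i j k) (Z k)"
    unfolding S_plus_def assms(1)
    by (rule arg_minI[where x = A]) (use assms(2) in auto)
  then show ?thesis using assms(2) by auto
qed

lemma S_minus_eq:
  assumes "circles_inter Z d i j = {A, B}" "dist A (Z k) < dist B (Z k)"
  shows "S_minus Z d i j k = B"
proof -
  have "S_minus Z d i j k \<in> {A, B} \<and> \<not> dist (S_minus Z d i j k) (Z k) < dist B (Z k)"
    unfolding S_minus_def assms(1)
    by (rule arg_maxI[where x = B]) (use assms(2) in auto)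
  then show ?thesis using assms(2) by auto
qed

section \<open>Coordinates for the triangle, and the threshold\<close>

lemma real2_orthonormal_expansion:
  fixes e g v :: "real^2"
  assumes "norm e = 1" "norm g = 1" "e \<bullet> g = 0"
  shows "v = (v \<bullet> e) *\<^sub>R e + (v \<bullet> g) *\<^sub>R g"
proof -
  have ne: "e \<noteq> g" "e \<noteq> 0" "g \<noteq> 0" using assms by auto
  have "pairwise orthogonal {e, g}"
    using assms by (auto simp: pairwise_def orthogonal_def inner_commute)
  then have "independent {e, g}"
    using ne by (intro pairwise_orthogonal_independent) auto
  then have "v \<in> span {e, g}"
    using card_ge_dim_independent[of "{e, g}" UNIV] ne by auto
  then obtain a b where "v = a *\<^sub>R e + b *\<^sub>R g"
    by (auto simp: span_insert span_singleton algebra_simps)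
  then show ?thesis
    using assms by (simp add: inner_add_left inner_commute[of g e] norm_eq_1)
qed

text \<open>The axes are the directions of the half base \<open>a\<close> and of the median
  \<open>b\<close> from Z3, with m and h their lengths. Noncollinearity makes both nonzero.\<close>

lemma isosceles_coordinates:
  fixes Z1 Z2 Z3 :: "real^2"
  assumes "\<not> collinear {Z1, Z2, Z3}" and "dist Z1 Z3 = dist Z2 Z3"
  obtains m h :: real and \<phi> :: "real \<Rightarrow> real \<Rightarrow> real^2"
  where "0 < m" "0 < h" "Z1 = \<phi> m h" "Z2 = \<phi> (- m) h" "Z3 = \<phi> 0 0"
    and "\<And>V. \<exists>x y. V = \<phi> x y"
    and "\<And>x y x' y'. dist (\<phi> x y) (\<phi> x' y') = sqrt ((x - x')\<^sup>2 + (y - y')\<^sup>2)"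
proof -
  define a b where "a = (1/2) *\<^sub>R (Z1 - Z2)" and "b = (1/2) *\<^sub>R (Z1 + Z2) - Z3"
  have ab: "Z1 - Z3 = b + a" "Z2 - Z3 = b - a"
    by (simp_all add: a_def b_def vec_eq_iff field_simps)
  have "a \<noteq> 0" using assms(1) by (auto simp: a_def collinear_2)
  have "b \<noteq> 0"
  proof
    assume "b = 0"
    then have "Z3 = midpoint Z1 Z2" by (simp add: b_def midpoint_def)
    then show False using assms(1)
      by (metis collinear_midpoint insert_commute)
  qed
  \<comment> \<open>Equal legs mean that b + a and b - a have the same norm.\<close>
  have "a \<bullet> b = 0"
    using assms(2) unfolding dist_norm ab norm_eq
    by (simp add: inner_add_left inner_diff_left inner_add_right inner_diff_right inner_commute)
  define e g where "e = sgn a" and "g = sgn b"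
  have eg: "norm e = 1" "norm g = 1" "e \<bullet> g = 0"
    using \<open>a \<noteq> 0\<close> \<open>b \<noteq> 0\<close> \<open>a \<bullet> b = 0\<close> by (auto simp: e_def g_def norm_sgn sgn_div_norm)
  define \<phi> where "\<phi> x y = Z3 + x *\<^sub>R e + y *\<^sub>R g" for x y
  have ea: "norm a *\<^sub>R e = a" "norm b *\<^sub>R g = b"
    using \<open>a \<noteq> 0\<close> \<open>b \<noteq> 0\<close> by (simp_all add: e_def g_def sgn_div_norm)
  show thesis
  proof (rule that)
    show "0 < norm a" "0 < norm b" using \<open>a \<noteq> 0\<close> \<open>b \<noteq> 0\<close> by auto
    show "Z1 = \<phi> (norm a) (norm b)" "Z2 = \<phi> (- norm a) (norm b)" "Z3 = \<phi> 0 0"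
      using ab by (simp_all add: \<phi>_def ea algebra_simps)
    show "\<exists>x y. V = \<phi> x y" for V
      using real2_orthonormal_expansion[OF eg, of "V - Z3"]
      unfolding \<phi>_def add.assoc diff_eq_eq add.commute[of _ Z3] by blast
    show "dist (\<phi> x y) (\<phi> x' y') = sqrt ((x - x')\<^sup>2 + (y - y')\<^sup>2)" for x y x' y'
    proof -
      have "\<phi> x y - \<phi> x' y' = (x - x') *\<^sub>R e + (y - y') *\<^sub>R g"
        by (simp add: \<phi>_def algebra_simps)
      then show ?thesis
        using eg by (simp add: dist_norm norm_eq_sqrt_inner inner_add_left inner_add_right
            inner_commute[of g e] power2_eq_square)
    qed
  qed
qed

text \<open>The threshold equals sqrt (L^2 + u^2) with u = 2 h c L / (L^2 - c^2), while D = sqrt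
  (L^2 + r^2). So u is the critical value of r, and clearing the denominator gives the sign
  conditions.\<close>

lemma threshold_compare:
  fixes Z :: "nat \<Rightarrow> real^2" and D r h :: real
  defines "c \<equiv> dist (Z 1) (Z 2)" and "L \<equiv> dist (Z 1) (Z 3)"
  assumes "c < L" "0 < c" "0 < r" "0 < h" "L\<^sup>2 = (c / 2)\<^sup>2 + h\<^sup>2"
    and D: "0 < D" "D\<^sup>2 = r\<^sup>2 + L\<^sup>2"
  shows "D < threshold Z \<longleftrightarrow> 0 < 2 * h * c * L - r * (L\<^sup>2 - c\<^sup>2)"
    and "D = threshold Z \<longleftrightarrow> 2 * h * c * L - r * (L\<^sup>2 - c\<^sup>2) = 0"
    and "threshold Z < D \<longleftrightarrow> 2 * h * c * L - r * (L\<^sup>2 - c\<^sup>2) < 0"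
proof -
  define K where "K = L\<^sup>2 - c\<^sup>2"
  have K: "0 < K" using assms(3,4) by (simp add: K_def power_strict_mono)
  define u where "u = 2 * h * c * L / K"
  have u: "0 < u" using assms(3-6) K by (simp add: u_def)
  have h2: "L\<^sup>2 - c\<^sup>2 / 4 = h\<^sup>2" using assms(7) by (simp add: power_divide)
  \<comment> \<open>This is (L^2 + c^2)^2 = (L^2 - c^2)^2 + 4 c^2 L^2 divided by K^2.\<close>
  have "((L\<^sup>2 + c\<^sup>2) / K)\<^sup>2 = 1 + 4 * c\<^sup>2 * L\<^sup>2 / K\<^sup>2"
    using K by (simp add: field_simps) (simp add: K_def power2_eq_square algebra_simps)
  then have "c\<^sup>2 / 4 + h\<^sup>2 * ((L\<^sup>2 + c\<^sup>2) / K)\<^sup>2 = L\<^sup>2 + u\<^sup>2"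
    using h2 by (simp add: u_def power_divide power_mult_distrib algebra_simps)
  then have thr: "threshold Z = sqrt (L\<^sup>2 + u\<^sup>2)"
    unfolding threshold_def c_def[symmetric] L_def[symmetric] h2 K_def by simp
  have DE: "D = sqrt (L\<^sup>2 + r\<^sup>2)"
    using real_sqrt_unique[OF D(2)] D(1) by (simp add: add.commute)
  have "r < u \<longleftrightarrow> 0 < 2 * h * c * L - r * K" "r = u \<longleftrightarrow> 2 * h * c * L - r * K = 0"
    "u < r \<longleftrightarrow> 2 * h * c * L - r * K < 0"
    using K by (auto simp: u_def field_simps)
  moreover have "r\<^sup>2 < u\<^sup>2 \<longleftrightarrow> r < u" "r\<^sup>2 = u\<^sup>2 \<longleftrightarrow> r = u" "u\<^sup>2 < r\<^sup>2 \<longleftrightarrow> u < r"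
    using assms(5) u
    by (auto simp only: power2_eq_iff_nonneg less_imp_le intro!: power_strict_mono
        elim!: power2_less_imp_less)
  ultimately show "D < threshold Z \<longleftrightarrow> 0 < 2 * h * c * L - r * (L\<^sup>2 - c\<^sup>2)"
    "D = threshold Z \<longleftrightarrow> 2 * h * c * L - r * (L\<^sup>2 - c\<^sup>2) = 0"
    "threshold Z < D \<longleftrightarrow> 2 * h * c * L - r * (L\<^sup>2 - c\<^sup>2) < 0"
    unfolding thr DE K_def[symmetric] by simp_all
qed

section \<open>Transfer from coordinates to the plane\<close>

locale isosceles_configuration = isosceles +
  fixes Z :: "nat \<Rightarrow> real^2" and d :: "nat \<Rightarrow> real" and \<phi> :: "real \<Rightarrow> real \<Rightarrow> real^2"
  assumes Z: "Z 1 = \<phi> m h" "Z 2 = \<phi> (- m) h" "Z 3 = \<phi> 0 0"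
    and d_pos: "0 < d 1" "0 < d 2"
    and d: "(d 1)\<^sup>2 = r\<^sup>2 + m\<^sup>2 + h\<^sup>2" "(d 2)\<^sup>2 = r\<^sup>2 + m\<^sup>2 + h\<^sup>2" "d 3 = r"
    and surj: "\<exists>x y. V = \<phi> x y"
    and dist: "dist (\<phi> x y) (\<phi> x' y') = sqrt ((x - x')\<^sup>2 + (y - y')\<^sup>2)"
begin

lemma \<phi>_eq_iff: "\<phi> x y = \<phi> x' y' \<longleftrightarrow> x = x' \<and> y = y'"
  using dist_eq_0_iff[of "\<phi> x y" "\<phi> x' y'"] unfolding dist by simp

lemma plane_eqI: "A = B" if "\<And>x y. \<phi> x y \<in> A \<longleftrightarrow> \<phi> x y \<in> B"
  using that surj by (metis subsetI subset_antisym)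

lemma norm_diff_power2: "(norm (\<phi> x y - \<phi> x' y'))\<^sup>2 = (x - x')\<^sup>2 + (y - y')\<^sup>2"
  unfolding dist_norm[symmetric] dist by simp

lemma objective_eq: "objective Z d (\<phi> x y) = F x y"
proof -
  have sum: "(\<Sum>j=1..3. g j) = g 1 + g 2 + g 3" for g :: "nat \<Rightarrow> real"
    by (simp add: eval_nat_numeral)
  have "(x - m)\<^sup>2 + (y - h)\<^sup>2 - (d 1)\<^sup>2 = f1 x y"
    "(x - (- m))\<^sup>2 + (y - h)\<^sup>2 - (d 2)\<^sup>2 = f2 x y"
    "(x - 0)\<^sup>2 + (y - 0)\<^sup>2 - (d 3)\<^sup>2 = f3 x y"
    unfolding d f1_def f2_def f3_def by algebra+
  then show ?thesis
    unfolding objective_def sum Z norm_diff_power2 F_def by (simp only:)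
qed

lemma minimizers_iff: "\<phi> x y \<in> minimizers Z d \<longleftrightarrow> F x y = F_min"
proof -
  have "\<phi> x y \<in> minimizers Z d \<longleftrightarrow> (\<forall>x' y'. F x y \<le> F x' y')"
    unfolding minimizers_def mem_Collect_eq
    using surj objective_eq by metis
  then show ?thesis unfolding F_minimal_iff .
qed

lemma sphere_iff:
  assumes "0 < \<rho>"
  shows "\<phi> x y \<in> sphere (\<phi> x' y') \<rho> \<longleftrightarrow> (x - x')\<^sup>2 + (y - y')\<^sup>2 = \<rho>\<^sup>2"
proof -
  have "\<rho> = sqrt (\<rho>\<^sup>2)" using assms by simp
  then show ?thesis
    unfolding mem_sphere dist by (metis power2_commute real_sqrt_eq_iff)
qed

lemma sphere_Z:
  "\<phi> x y \<in> sphere (Z 1) (d 1) \<longleftrightarrow> (x - m)\<^sup>2 + (y - h)\<^sup>2 = r\<^sup>2 + m\<^sup>2 + h\<^sup>2"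
  "\<phi> x y \<in> sphere (Z 2) (d 2) \<longleftrightarrow> (x + m)\<^sup>2 + (y - h)\<^sup>2 = r\<^sup>2 + m\<^sup>2 + h\<^sup>2"
  "\<phi> x y \<in> sphere (Z 3) (d 3) \<longleftrightarrow> x\<^sup>2 + y\<^sup>2 = r\<^sup>2"
  unfolding Z d(3) sphere_iff[OF d_pos(1)] sphere_iff[OF d_pos(2)] sphere_iff[OF pos(3)] d
  by simp_all

lemma circles_inter_eq:
  "circles_inter Z d 1 2 = {\<phi> 0 (- y0), \<phi> 0 (y0 + 2 * h)}"
  "circles_inter Z d 2 3 = {\<phi> p q, \<phi> (- p) (- q)}"
  "circles_inter Z d 3 1 = {\<phi> (- p) q, \<phi> p (- q)}"
  subgoal
    by (rule plane_eqI, unfold circles_inter_def Int_iff sphere_Z insert_iff empty_iff \<phi>_eq_iff)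
      (use circles_12 in blast)
  subgoal
    by (rule plane_eqI, unfold circles_inter_def Int_iff sphere_Z insert_iff empty_iff \<phi>_eq_iff)
      (use circles_3[of "- 1"] in auto)
  subgoal
    by (rule plane_eqI, unfold circles_inter_def Int_iff sphere_Z insert_iff empty_iff \<phi>_eq_iff)
      (use circles_3[of "1"] in auto)
  done

lemma S_plus_12: "S_plus Z d 1 2 3 = \<phi> 0 (- y0)"
proof (rule S_plus_eq[OF circles_inter_eq(1)])
  show "dist (\<phi> 0 (- y0)) (Z 3) < dist (\<phi> 0 (y0 + 2 * h)) (Z 3)"
    unfolding Z dist using pos by simp
qed

text \<open>The inner product of (p, q) with Z_1 = (m, h) is positive, so (p, q) is nearer to Z_1
  than its antipode.\<close>

lemma S_23: "S_plus Z d 2 3 1 = \<phi> p q" "S_minus Z d 2 3 1 = \<phi> (- p) (- q)"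
proof -
  have "0 < m * p" "0 < h * q" using pos by simp_all
  then have "dist (\<phi> p q) (Z 1) < dist (\<phi> (- p) (- q)) (Z 1)"
    unfolding Z dist by (simp add: power2_eq_square algebra_simps)
  then show "S_plus Z d 2 3 1 = \<phi> p q" "S_minus Z d 2 3 1 = \<phi> (- p) (- q)"
    using S_plus_eq S_minus_eq circles_inter_eq(2) by blast+
qed

lemma S_31: "S_plus Z d 3 1 2 = \<phi> (- p) q" "S_minus Z d 3 1 2 = \<phi> p (- q)"
proof -
  have "0 < m * p" "0 < h * q" using pos by simp_all
  then have "dist (\<phi> (- p) q) (Z 2) < dist (\<phi> p (- q)) (Z 2)"
    unfolding Z dist by (simp add: power2_eq_square algebra_simps)
  then show "S_plus Z d 3 1 2 = \<phi> (- p) q" "S_minus Z d 3 1 2 = \<phi> p (- q)"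
    using S_plus_eq S_minus_eq circles_inter_eq(3) by blast+
qed

lemma minimizers_less:
  assumes "2 * h * y0 < 4 * m * p"
  shows "minimizers Z d = {S_plus Z d 1 2 3}"
  unfolding S_plus_12
  by (rule plane_eqI, unfold minimizers_iff F_eq_F_min_iff insert_iff empty_iff \<phi>_eq_iff)
    (use assms less_imp_le[OF assms] not_le in blast)

lemma minimizers_eq:
  assumes "2 * h * y0 = 4 * m * p"
  shows "minimizers Z d = {S_plus Z d 1 2 3, S_plus Z d 2 3 1, S_minus Z d 2 3 1,
    S_plus Z d 3 1 2, S_minus Z d 3 1 2}"
  unfolding S_plus_12 S_23 S_31
  by (rule plane_eqI, unfold minimizers_iff F_eq_F_min_iff insert_iff empty_iff \<phi>_eq_iff)
    (use eq_refl[OF assms] eq_refl[OF assms[symmetric]] in blast)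

lemma minimizers_greater:
  assumes "4 * m * p < 2 * h * y0"
  shows "minimizers Z d = {S_plus Z d 2 3 1, S_minus Z d 2 3 1,
    S_plus Z d 3 1 2, S_minus Z d 3 1 2}"
  unfolding S_23 S_31
  by (rule plane_eqI, unfold minimizers_iff F_eq_F_min_iff insert_iff empty_iff \<phi>_eq_iff)
    (use assms less_imp_le[OF assms] not_le in blast)

end

section \<open>Choice of the parameters and the three cases\<close>

theorem theorem3:
  fixes Z :: "nat \<Rightarrow> real^2" and d :: "nat \<Rightarrow> real"
  assumes "\<not> collinear {Z 1, Z 2, Z 3}"
    and "d 1 > 0" and "d 2 > 0" and "d 3 > 0"
    and "dist (Z 1) (Z 3) = dist (Z 2) (Z 3)"
    and "d 1 = d 2" and "d 2 > dist (Z 1) (Z 3)"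
    and "(d 3)\<^sup>2 = (d 1)\<^sup>2 - (dist (Z 1) (Z 3))\<^sup>2"
  shows "(dist (Z 1) (Z 3) \<le> dist (Z 1) (Z 2) \<or>
            (dist (Z 1) (Z 3) > dist (Z 1) (Z 2) \<and> d 1 < threshold Z) \<longrightarrow>
          minimizers Z d = {S_plus Z d 1 2 3}) \<and>
         (dist (Z 1) (Z 3) > dist (Z 1) (Z 2) \<and> d 1 = threshold Z \<longrightarrow>
          minimizers Z d = {S_plus Z d 1 2 3, S_plus Z d 2 3 1, S_minus Z d 2 3 1,
                            S_plus Z d 3 1 2, S_minus Z d 3 1 2}) \<and>
         (dist (Z 1) (Z 3) > dist (Z 1) (Z 2) \<and> d 1 > threshold Z \<longrightarrow>
          minimizers Z d = {S_plus Z d 2 3 1, S_minus Z d 2 3 1,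
                            S_plus Z d 3 1 2, S_minus Z d 3 1 2})"
proof -
  obtain m h \<phi> where mh: "0 < m" "0 < h"
    and Z: "Z 1 = \<phi> m h" "Z 2 = \<phi> (- m) h" "Z 3 = \<phi> 0 0"
    and surj: "\<And>V. \<exists>x y. V = \<phi> x y"
    and dist: "\<And>x y x' y'. dist (\<phi> x y) (\<phi> x' y') = sqrt ((x - x')\<^sup>2 + (y - y')\<^sup>2)"
    by (rule isosceles_coordinates[OF assms(1,5)]) (rule that)
  define r L where "r = d 3" and "L = dist (Z 1) (Z 3)"
  define y0 where "y0 = sqrt (h\<^sup>2 + r\<^sup>2) - h"
  \<comment> \<open>The vector of length r orthogonal to Z_2 = (-m, h), the direction of the radical
    axis of circles 2 and 3.\<close>
  define p q where "p = h * r / L" and "q = m * r / L"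
  have r: "0 < r" using assms(4) by (simp add: r_def)
  have "L = sqrt (m\<^sup>2 + h\<^sup>2)" unfolding L_def Z dist by simp
  then have L: "0 < L" and L2: "L\<^sup>2 = m\<^sup>2 + h\<^sup>2"
    using mh by (simp_all add: add_pos_pos)
  have d1: "(d 1)\<^sup>2 = r\<^sup>2 + L\<^sup>2"
    unfolding r_def L_def using assms(8) by algebra
  have qL: "q * L = m * r" using L by (simp add: q_def)
  have iso: "isosceles m h r y0 p q"
  proof
    show "0 < y0" using mh r by (simp add: y0_def real_less_rsqrt)
    show "y0\<^sup>2 + 2 * h * y0 = r\<^sup>2"
      by (simp add: y0_def power2_diff algebra_simps power2_eq_square[symmetric])
    have "p\<^sup>2 + q\<^sup>2 = r\<^sup>2 * (m\<^sup>2 + h\<^sup>2) / L\<^sup>2"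
      by (simp add: p_def q_def power_divide power_mult_distrib add_divide_distrib algebra_simps)
    then show "p\<^sup>2 + q\<^sup>2 = r\<^sup>2" using L by (simp flip: L2)
  qed (use mh r L in \<open>auto simp: p_def q_def\<close>)
  have "isosceles_configuration_axioms m h r Z d \<phi>"
  proof
    show "(d 1)\<^sup>2 = r\<^sup>2 + m\<^sup>2 + h\<^sup>2" "(d 2)\<^sup>2 = r\<^sup>2 + m\<^sup>2 + h\<^sup>2"
      using d1 assms(6) L2 by simp_all
  qed (fact Z assms(2,3) r_def[symmetric] surj dist)+
  with iso have conf: "isosceles_configuration m h r y0 p q Z d \<phi>"
    by (rule isosceles_configuration.intro)

  \<comment> \<open>Comparing the candidate values and comparing \<open>d 1\<close> with the
    threshold both reduce to the sign of \<Delta>.\<close>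
  define \<Delta> where "\<Delta> = 2 * h * (2 * m) * L - r * (L\<^sup>2 - (2 * m)\<^sup>2)"
  have c: "dist (Z 1) (Z 2) = 2 * m"
    unfolding Z dist using mh by (simp add: real_sqrt_mult)
  note cmp = isosceles.value_compare[OF iso L qL, folded \<Delta>_def]
  \<comment> \<open>If the legs are no longer than the base, the subtracted term is nonpositive, so
    case (i) follows without the threshold.\<close>
  have le: "0 < \<Delta>" if "L \<le> 2 * m"
  proof -
    have "L\<^sup>2 \<le> (2 * m)\<^sup>2" using that L by (intro power_mono) auto
    then have "r * (L\<^sup>2 - (2 * m)\<^sup>2) \<le> 0" using r by (simp add: mult_le_0_iff)
    moreover have "0 < 2 * h * (2 * m) * L" using mh L by simp
    ultimately show ?thesis unfolding \<Delta>_def by linarith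
  qed
  have L2': "L\<^sup>2 = (2 * m / 2)\<^sup>2 + h\<^sup>2" using L2 by simp
  have "0 < 2 * m" using mh by simp
  note thr = threshold_compare[of Z, unfolded c, folded L_def, OF _ this r mh(2) L2' assms(2) d1,
      folded \<Delta>_def]
  show ?thesis
    unfolding L_def[symmetric] c
  proof (intro conjI impI)
    assume "L \<le> 2 * m \<or> 2 * m < L \<and> d 1 < threshold Z"
    then have "0 < \<Delta>" using le thr(1) by blast
    then show "minimizers Z d = {S_plus Z d 1 2 3}"
      by (intro isosceles_configuration.minimizers_less[OF conf] cmp(1)[THEN iffD2])
  next
    assume "2 * m < L \<and> d 1 = threshold Z"
    then have "\<Delta> = 0" using thr(2) by blast
    then show "minimizers Z d = {S_plus Z d 1 2 3, S_plus Z d 2 3 1, S_minus Z d 2 3 1,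
        S_plus Z d 3 1 2, S_minus Z d 3 1 2}"
      by (intro isosceles_configuration.minimizers_eq[OF conf] cmp(2)[THEN iffD2])
  next
    assume "2 * m < L \<and> threshold Z < d 1"
    then have "\<Delta> < 0" using thr(3) by blast
    then show "minimizers Z d = {S_plus Z d 2 3 1, S_minus Z d 2 3 1,
        S_plus Z d 3 1 2, S_minus Z d 3 1 2}"
      by (intro isosceles_configuration.minimizers_greater[OF conf] cmp(3)[THEN iffD2])
  qed
qed

end
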